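(* Let $A_0$ be a unital $C^*$-algebra and $\mathcal A_0\subseteq A_0$ a norm-dense unital $*$-subalgebra. Let $X$ be a right Hilbert $C^*$-module over $A_0$ with norm $\|\cdot\|$, and let $\mathcal X\subseteq X$ be a norm-dense subspace with $\mathcal X\cdot\mathcal A_0\subseteq\mathcal X$ and $\langle\mathcal X,\mathcal X\rangle\subseteq\mathcal A_0$. Let $L:\mathcal X\to[0,\infty)$ be a seminorm and $L_0:\mathcal A_0\to[0,\infty)$ a slip-norm such that $(\mathcal A_0,L_0)$ is a compact quantum metric space. Suppose that $\mathcal X$ has a finite frame $\zeta_1,\dots,\zeta_n$ such that (1) there is a constant $C\ge0$ with $\|x\|\le C\cdot L(x)$ for all $x\in\mathcal X$; (2) there is a constant $C_0\ge 0$ with $L_0(\langle\zeta_j,x\rangle)\le C_0\cdot(L(x)+\|x\|)$ for all $x\in\mathcal X$ and $j\in\{1,\dots,n\}$. Then the set $\{x\in\mathcal X:L(x)\le1\}$ is totally bounded in $X$.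
   Context: A finite frame for $\mathcal X$ is a finite family $\zeta_1,\dots,\zeta_n\in\mathcal X$ with $\sum_{j=1}^n\zeta_j\cdot\langle\zeta_j,x\rangle=x$ for all $x\in\mathcal X$. A slip-norm on an operator system $\mathcal E$ (a subspace of a unital $C^*$-algebra containing $1$ and closed under adjoints) is a seminorm $L$ with $L(1)=0$, $L(x^* )=L(x)$; $(\mathcal E,L)$ is a compact quantum metric space if the metric $d_L(\mu,\nu)=\sup\{|\mu(x)-\nu(x)|:L(x)\le 1\}$ on the state space of $\mathcal E$ induces the weak$^*$ topology. *)

theory Defs
  imports "HOL-Analysis.Analysis"
begin

text \<open>HOL has no class of complex vector spaces.  A complex unital Banach algebra is
encoded as a real unital Banach algebra (type class real_normed_algebra_1 and banach)
together with a central element ii with ii * ii = -1 and a complex-homogeneous norm.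
Complex scalar multiplication is then cscale.\<close>

definition cscale :: "'a::real_normed_algebra_1 \<Rightarrow> complex \<Rightarrow> 'a \<Rightarrow> 'a" where
  "cscale ii c x = Re c *\<^sub>R x + Im c *\<^sub>R (ii * x)"

definition unital_cstar_algebra ::
  "('a::{real_normed_algebra_1,banach} \<Rightarrow> 'a) \<Rightarrow> 'a \<Rightarrow> bool" where
  "unital_cstar_algebra star ii \<longleftrightarrow>
     ii * ii = - 1 \<and> (\<forall>x. ii * x = x * ii) \<and>
     (\<forall>c x. norm (cscale ii c x) = cmod c * norm x) \<and>
     (\<forall>x y. star (x + y) = star x + star y) \<and>
     (\<forall>c x. star (cscale ii c x) = cscale ii (cnj c) (star x)) \<and>
     (\<forall>x y. star (x * y) = star y * star x) \<and>
     (\<forall>x. star (star x) = x) \<and>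
     (\<forall>x. norm (star x * x) = (norm x)\<^sup>2)"

definition cstar_positive :: "('a::real_normed_algebra_1 \<Rightarrow> 'a) \<Rightarrow> 'a \<Rightarrow> bool" where
  "cstar_positive star a \<longleftrightarrow> (\<exists>b. a = star b * b)"

definition unital_star_subalgebra ::
  "('a::real_normed_algebra_1 \<Rightarrow> 'a) \<Rightarrow> 'a \<Rightarrow> 'a set \<Rightarrow> bool" where
  "unital_star_subalgebra star ii E \<longleftrightarrow>
     1 \<in> E \<and> (\<forall>x\<in>E. \<forall>y\<in>E. x + y \<in> E \<and> x * y \<in> E) \<and>
     (\<forall>c. \<forall>x\<in>E. cscale ii c x \<in> E) \<and> (\<forall>x\<in>E. star x \<in> E)"

text \<open>The module is a real Banach space 'x with a right action act of the algebra
and an A-valued inner product ip, linear in the second variable.  The complex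
scalar multiplication on the module is x \<mapsto> x \<cdot> (c 1).  The norm of the type
is required to be the Hilbert-module norm, and completeness comes from banach.\<close>

definition mscale :: "('x \<Rightarrow> 'a \<Rightarrow> 'x) \<Rightarrow> 'a::real_normed_algebra_1 \<Rightarrow> complex \<Rightarrow> 'x \<Rightarrow> 'x" where
  "mscale act ii c x = act x (cscale ii c 1)"

definition right_hilbert_module ::
  "('a::{real_normed_algebra_1,banach} \<Rightarrow> 'a) \<Rightarrow> 'a \<Rightarrow>
   ('x::{real_normed_vector,banach} \<Rightarrow> 'a \<Rightarrow> 'x) \<Rightarrow> ('x \<Rightarrow> 'x \<Rightarrow> 'a) \<Rightarrow> bool" where
  "right_hilbert_module star ii act ip \<longleftrightarrow>
     (\<forall>x y a. act (x + y) a = act x a + act y a) \<and>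
     (\<forall>x a b. act x (a + b) = act x a + act x b) \<and>
     (\<forall>r x a. act (r *\<^sub>R x) a = r *\<^sub>R act x a \<and> act x (r *\<^sub>R a) = r *\<^sub>R act x a) \<and>
     (\<forall>x a b. act (act x a) b = act x (a * b)) \<and>
     (\<forall>x. act x 1 = x) \<and>
     (\<forall>x y z. ip x (y + z) = ip x y + ip x z) \<and>
     (\<forall>r x y. ip x (r *\<^sub>R y) = r *\<^sub>R ip x y) \<and>
     (\<forall>x y a. ip x (act y a) = ip x y * a) \<and>
     (\<forall>x y. ip y x = star (ip x y)) \<and>
     (\<forall>x. cstar_positive star (ip x x)) \<and>
     (\<forall>x. ip x x = 0 \<longrightarrow> x = 0) \<and>
     (\<forall>x. norm x = sqrt (norm (ip x x)))"

definition module_seminorm_on ::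
  "('x::real_vector \<Rightarrow> 'a \<Rightarrow> 'x) \<Rightarrow> 'a::real_normed_algebra_1 \<Rightarrow> 'x set \<Rightarrow> ('x \<Rightarrow> real) \<Rightarrow> bool" where
  "module_seminorm_on act ii S L \<longleftrightarrow>
     (\<forall>x\<in>S. 0 \<le> L x) \<and> (\<forall>x\<in>S. \<forall>y\<in>S. L (x + y) \<le> L x + L y) \<and>
     (\<forall>c. \<forall>x\<in>S. L (mscale act ii c x) = cmod c * L x)"

definition slip_norm ::
  "('a::real_normed_algebra_1 \<Rightarrow> 'a) \<Rightarrow> 'a \<Rightarrow> 'a set \<Rightarrow> ('a \<Rightarrow> real) \<Rightarrow> bool" where
  "slip_norm star ii E L \<longleftrightarrow>
     (\<forall>x\<in>E. 0 \<le> L x) \<and> (\<forall>x\<in>E. \<forall>y\<in>E. L (x + y) \<le> L x + L y) \<and>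
     (\<forall>c. \<forall>x\<in>E. L (cscale ii c x) = cmod c * L x) \<and>
     L 1 = 0 \<and> (\<forall>x\<in>E. L (star x) = L x)"

definition states :: "'a::real_normed_algebra_1 \<Rightarrow> 'a set \<Rightarrow> ('a \<Rightarrow> complex) set" where
  "states ii E = {\<mu>. \<mu> \<in> extensional E \<and>
      (\<forall>x\<in>E. \<forall>y\<in>E. \<mu> (x + y) = \<mu> x + \<mu> y) \<and>
      (\<forall>c. \<forall>x\<in>E. \<mu> (cscale ii c x) = c * \<mu> x) \<and>
      \<mu> 1 = 1 \<and> (\<forall>x\<in>E. cmod (\<mu> x) \<le> norm x)}"

definition weak_star_topology :: "'a::real_normed_algebra_1 \<Rightarrow> 'a set \<Rightarrow> ('a \<Rightarrow> complex) topology" where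
  "weak_star_topology ii E = subtopology (product_topology (\<lambda>_. euclidean) E) (states ii E)"

definition dL :: "'a set \<Rightarrow> ('a \<Rightarrow> real) \<Rightarrow> ('a \<Rightarrow> complex) \<Rightarrow> ('a \<Rightarrow> complex) \<Rightarrow> real" where
  "dL E L \<mu> \<nu> = Sup {cmod (\<mu> x - \<nu> x) | x. x \<in> E \<and> L x \<le> 1}"

definition compact_quantum_metric_space ::
  "('a::real_normed_algebra_1 \<Rightarrow> 'a) \<Rightarrow> 'a \<Rightarrow> 'a set \<Rightarrow> ('a \<Rightarrow> real) \<Rightarrow> bool" where
  "compact_quantum_metric_space star ii E L \<longleftrightarrow>
     slip_norm star ii E L \<and>
     (let S = states ii E; d = (\<lambda>\<mu> \<nu>. if \<mu> \<in> S \<and> \<nu> \<in> S then dL E L \<mu> \<nu> else 0) in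
       (\<forall>\<mu>\<in>S. \<forall>\<nu>\<in>S. bdd_above {cmod (\<mu> x - \<nu> x) | x. x \<in> E \<and> L x \<le> 1}) \<and>
       Metric_space S d \<and>
       Metric_space.mtopology S d = weak_star_topology ii E)"

definition finite_frame ::
  "('x::real_vector \<Rightarrow> 'a \<Rightarrow> 'x) \<Rightarrow> ('x \<Rightarrow> 'x \<Rightarrow> 'a) \<Rightarrow> 'x set \<Rightarrow> nat \<Rightarrow> (nat \<Rightarrow> 'x) \<Rightarrow> bool" where
  "finite_frame act ip S n \<zeta> \<longleftrightarrow>
     (\<forall>j<n. \<zeta> j \<in> S) \<and> (\<forall>x\<in>S. (\<Sum>j<n. act (\<zeta> j) (ip (\<zeta> j) x)) = x)"

end

theory Submission
  imports Defs
begin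

text \<open>States control the norm, norm a \<le> 10 sup {|\<mu> a|}: a Hahn-Banach argument realizes the
right derivative p(a) of t \<mapsto> norm (1 + t a) at 0 as the real part of \<mu> a for a state \<mu>, while
norm (exp a) \<le> exp (p(a)), and exp x - exp (-x) - i exp (ix) + i exp (-ix) = 4 x + O(x^5).
The state space is weak* compact, hence totally bounded for the metric d_L.  An element a with
L0 a \<le> R and norm a \<le> R is an R-Lipschitz function of the state, so it is determined up to a
small error in norm by its values on a finite net of states; such elements therefore form a totally
bounded set.  The reconstruction x = \<Sum> \<zeta> j <\<zeta> j, x> transports this to the module, because the
frame coefficients of {x. L x \<le> 1} lie in such a set.\<close>

subsection \<open>Hahn-Banach extension\<close>

definition sublinear :: "('v::real_vector \<Rightarrow> real) \<Rightarrow> bool" where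
  "sublinear p \<longleftrightarrow> (\<forall>x y. p (x + y) \<le> p x + p y) \<and> (\<forall>t\<ge>0. \<forall>x. p (t *\<^sub>R x) = t * p x)"

lemma sublinear_add: "sublinear p \<Longrightarrow> p (x + y) \<le> p x + p y"
  and sublinear_scaleR: "sublinear p \<Longrightarrow> t \<ge> 0 \<Longrightarrow> p (t *\<^sub>R x) = t * p x"
  by (auto simp: sublinear_def)

lemma sublinear_zero: "sublinear p \<Longrightarrow> p 0 = 0"
  using sublinear_scaleR[of p 0 0] by simp

lemma sublinear_minus: "sublinear p \<Longrightarrow> - p (- x) \<le> p x"
  using sublinear_add[of p x "- x"] sublinear_zero[of p] by simp

text \<open>Adding the requirement f a = q a to the condition f \<le> q amounts to f \<le> tilt q a.\<close>

definition tilt :: "('v::real_vector \<Rightarrow> real) \<Rightarrow> 'v \<Rightarrow> 'v \<Rightarrow> real" where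
  "tilt q a x = (INF t\<in>{0..}. q (x + t *\<^sub>R a) - t * q a)"

lemma tilt_le:
  assumes "sublinear q" "t \<ge> 0"
  shows "tilt q a x \<le> q (x + t *\<^sub>R a) - t * q a"
  unfolding tilt_def
proof (rule cINF_lower)
  show "bdd_below ((\<lambda>t. q (x + t *\<^sub>R a) - t * q a) ` {0..})"
  proof (rule bdd_belowI2)
    fix t :: real assume "t \<in> {0..}"
    \<comment> \<open>Subadditivity applied to
      \<open>t *\<^sub>R a = - x + (x + t *\<^sub>R a)\<close> gives a lower bound that does not
      depend on \<open>t\<close>, so the infimum is a genuine one.\<close>
    then show "- q (- x) \<le> q (x + t *\<^sub>R a) - t * q a"
      using sublinear_add[OF assms(1), of "- x" "x + t *\<^sub>R a"] sublinear_scaleR[OF assms(1), of t a]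
      by simp
  qed
qed (use assms in auto)

lemma tilt_greatest:
  assumes "\<And>t. t \<ge> 0 \<Longrightarrow> c \<le> q (x + t *\<^sub>R a) - t * q a"
  shows "c \<le> tilt q a x"
  unfolding tilt_def using assms by (intro cINF_greatest) auto

text \<open>Shifts \<open>s\<close> for \<open>x\<close> and \<open>t\<close> for \<open>y\<close>
  combine into the shift \<open>s + t\<close> for \<open>x + y\<close>, and scaling by
  \<open>r\<close> turns the shift \<open>t / r\<close> into \<open>t\<close>.\<close>

lemma sublinear_tilt:
  assumes q: "sublinear q"
  shows "sublinear (tilt q a)"
proof -
  have add: "tilt q a (x + y) \<le> tilt q a x + tilt q a y" for x y
  proof -
    \<comment> \<open>The two infima are taken one after the other: first over \<open>t\<close> with
      \<open>s\<close> fixed, then over \<open>s\<close>.\<close>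
    have "tilt q a (x + y) - (q (x + s *\<^sub>R a) - s * q a) \<le> tilt q a y" if "s \<ge> 0" for s
    proof (rule tilt_greatest)
      fix t :: real assume "t \<ge> 0"
      have "tilt q a (x + y) \<le> q ((x + y) + (s + t) *\<^sub>R a) - (s + t) * q a"
        using tilt_le[OF q, of "s + t"] \<open>s \<ge> 0\<close> \<open>t \<ge> 0\<close> by simp
      also have "(x + y) + (s + t) *\<^sub>R a = (x + s *\<^sub>R a) + (y + t *\<^sub>R a)"
        by (simp add: algebra_simps)
      also have "q \<dots> \<le> q (x + s *\<^sub>R a) + q (y + t *\<^sub>R a)" by (rule sublinear_add[OF q])
      finally show "tilt q a (x + y) - (q (x + s *\<^sub>R a) - s * q a) \<le> q (y + t *\<^sub>R a) - t * q a"
        by (simp add: algebra_simps)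
    qed
    then have "tilt q a (x + y) - tilt q a y \<le> tilt q a x"
      by (intro tilt_greatest) (smt (verit))
    then show ?thesis by simp
  qed
  have pos_le: "r * tilt q a x \<le> tilt q a (r *\<^sub>R x)" if "r > 0" for r x
  proof (rule tilt_greatest)
    fix t :: real assume "t \<ge> 0"
    have "r * tilt q a x \<le> r * (q (x + (t / r) *\<^sub>R a) - (t / r) * q a)"
      using that \<open>t \<ge> 0\<close> by (intro mult_left_mono tilt_le q) auto
    also have "\<dots> = q (r *\<^sub>R (x + (t / r) *\<^sub>R a)) - t * q a"
      using that by (simp add: sublinear_scaleR[OF q] right_diff_distrib)
    also have "r *\<^sub>R (x + (t / r) *\<^sub>R a) = r *\<^sub>R x + t *\<^sub>R a"
      using that by (simp add: scaleR_add_right)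
    finally show "r * tilt q a x \<le> q (r *\<^sub>R x + t *\<^sub>R a) - t * q a" .
  qed
  have zero: "tilt q a 0 = 0"
  proof (rule antisym)
    show "tilt q a 0 \<le> 0" using tilt_le[OF q, of 0 a 0] sublinear_zero[OF q] by simp
    show "0 \<le> tilt q a 0" by (rule tilt_greatest) (simp add: sublinear_scaleR[OF q])
  qed
  have "tilt q a (r *\<^sub>R x) = r * tilt q a x" if "r \<ge> 0" for r x
  proof (cases "r = 0")
    case False
    then have "r > 0" using that by simp
    \<comment> \<open>The converse of \<open>pos_le\<close> is \<open>pos_le\<close> itself, applied
      to \<open>inverse r\<close> and the scaled vector.\<close>
    have "inverse r * tilt q a (r *\<^sub>R x) \<le> tilt q a x"
      using pos_le[of "inverse r" "r *\<^sub>R x"] \<open>r > 0\<close> by simp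
    then have "tilt q a (r *\<^sub>R x) \<le> r * tilt q a x"
      using \<open>r > 0\<close> by (simp add: field_simps)
    with pos_le[OF \<open>r > 0\<close>, of x] show ?thesis by simp
  qed (simp add: zero)
  with add show ?thesis by (simp add: sublinear_def)
qed

text \<open>Since \<open>tilt q a\<close> is sublinear and lies below \<open>q\<close>, minimality
  makes the two equal. Evaluating at \<open>- a\<close> with shift 1 then yields
  \<open>q (- a) \<le> - q a\<close>, and an odd sublinear functional is linear.\<close>

lemma minimal_sublinear_linear:
  assumes q: "sublinear q"
    and minimal: "\<And>r. sublinear r \<Longrightarrow> (\<And>x. r x \<le> q x) \<Longrightarrow> r = q"
  shows "linear q"
proof -
  have minus: "q (- a) = - q a" for a
  proof -
    have "tilt q a = q"
    proof (rule minimal[OF sublinear_tilt[OF q]])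
      show "tilt q a x \<le> q x" for x using tilt_le[OF q, of 0 a x] by simp
    qed
    then have "q (- a) \<le> - q a"
      using tilt_le[OF q, of 1 a "- a"] sublinear_zero[OF q] by simp
    then show ?thesis using sublinear_minus[OF q, of a] by simp
  qed
  show ?thesis
  proof (rule linearI)
    fix x y show "q (x + y) = q x + q y"
      using sublinear_add[OF q, of x y] sublinear_add[OF q, of "x + y" "- y"] minus[of y] by simp
  next
    fix r x show "q (r *\<^sub>R x) = r *\<^sub>R q x"
    proof (cases "r \<ge> 0")
      case False
      then have "q (r *\<^sub>R x) = - q ((- r) *\<^sub>R x)" using minus[of "(- r) *\<^sub>R x"] by simp
      then show ?thesis using False sublinear_scaleR[OF q, of "- r" x] by simp
    qed (simp add: sublinear_scaleR[OF q])
  qed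
qed

text \<open>Supplies the lower bounds for Zorn's lemma. The chain condition enters in subadditivity:
  \<open>q x + r y\<close> dominates the smaller of \<open>q\<close> and \<open>r\<close> evaluated
  at \<open>x + y\<close>. The common majorant \<open>p\<close> keeps the infimum finite, because
  \<open>- p (- x) \<le> q x\<close>.\<close>

lemma sublinear_INF_chain:
  assumes ne: "C \<noteq> {}" and sub: "\<And>q. q \<in> C \<Longrightarrow> sublinear q"
    and le: "\<And>q x. q \<in> C \<Longrightarrow> q x \<le> p x"
    and chain: "\<And>q r. q \<in> C \<Longrightarrow> r \<in> C \<Longrightarrow> (\<forall>x. q x \<le> r x) \<or> (\<forall>x. r x \<le> q x)"
  shows "sublinear (\<lambda>x. INF q\<in>C. q x)" and "q \<in> C \<Longrightarrow> (INF q\<in>C. q x) \<le> q x"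
proof -
  have bdd: "bdd_below ((\<lambda>q. q x) ` C)" for x
  proof (rule bdd_belowI2)
    show "- p (- x) \<le> q x" if "q \<in> C" for q
      using sublinear_minus[OF sub[OF that], of x] le[OF that, of "- x"] by simp
  qed
  show lower: "(INF q\<in>C. q x) \<le> q x" if "q \<in> C" for q x
    by (rule cINF_lower[OF bdd that])
  have "(INF q\<in>C. q (x + y)) \<le> (INF q\<in>C. q x) + (INF q\<in>C. q y)" for x y
  proof -
    have pair: "(INF q\<in>C. q (x + y)) \<le> q x + r y" if "q \<in> C" "r \<in> C" for q r
      using chain[OF that]
    proof
      assume "\<forall>x. q x \<le> r x"
      then show ?thesis
        using lower[OF that(1), of "x + y"] sublinear_add[OF sub[OF that(1)], of x y]
        by (smt (verit))
    next
      assume "\<forall>x. r x \<le> q x"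
      then show ?thesis
        using lower[OF that(2), of "x + y"] sublinear_add[OF sub[OF that(2)], of x y]
        by (smt (verit))
    qed
    have "(INF q\<in>C. q (x + y)) - q x \<le> (INF q\<in>C. q y)" if "q \<in> C" for q
      using pair[OF that] by (intro cINF_greatest ne) (simp add: algebra_simps)
    then have "(INF q\<in>C. q (x + y)) - (INF q\<in>C. q y) \<le> (INF q\<in>C. q x)"
      by (intro cINF_greatest ne) (simp add: algebra_simps)
    then show ?thesis by simp
  qed
  moreover have "(INF q\<in>C. q (t *\<^sub>R x)) = t * (INF q\<in>C. q x)" if "t \<ge> 0" for t x
  proof (cases "t = 0")
    case True
    then show ?thesis using ne sub by (simp add: sublinear_zero)
  next
    case False
    have "(INF q\<in>C. q (t *\<^sub>R x)) = (INF q\<in>C. t * q x)"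
      using sub that by (intro INF_cong) (auto simp: sublinear_scaleR)
    also have "\<dots> = t * (INF q\<in>C. q x)"
    proof (rule antisym)
      show "t * (INF q\<in>C. q x) \<le> (INF q\<in>C. t * q x)"
        using lower that by (intro cINF_greatest ne mult_left_mono) auto
      have "(INF q\<in>C. t * q x) / t \<le> q x" if "q \<in> C" for q
      proof -
        have "bdd_below ((\<lambda>q. t * q x) ` C)"
          using bdd[of x] \<open>t \<ge> 0\<close> by (auto simp: bdd_below_def intro!: mult_left_mono)
        then have "(INF q\<in>C. t * q x) \<le> t * q x" by (rule cINF_lower[OF _ that])
        then show ?thesis using \<open>t \<ge> 0\<close> False by (simp add: field_simps)
      qed
      then have "(INF q\<in>C. t * q x) / t \<le> (INF q\<in>C. q x)"
        by (intro cINF_greatest ne)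
      then show "(INF q\<in>C. t * q x) \<le> t * (INF q\<in>C. q x)"
        using \<open>t \<ge> 0\<close> False by (simp add: field_simps)
    qed
    finally show ?thesis .
  qed
  ultimately show "sublinear (\<lambda>x. INF q\<in>C. q x)" by (simp add: sublinear_def)
qed

lemma linear_below_sublinear:
  fixes p :: "'v::real_vector \<Rightarrow> real"
  assumes p: "sublinear p"
  obtains f where "linear f" "\<And>x. f x \<le> p x"
proof -
  define A where "A = {q. sublinear q \<and> (\<forall>x. q x \<le> p x)}"
  \<comment> \<open>The order is reversed, so a maximal element in Zorn's lemma is a minimal
    sublinear functional.\<close>
  define P where "P = (\<lambda>q r :: 'v \<Rightarrow> real. \<forall>x. r x \<le> q x)"
  have "\<exists>m\<in>A. \<forall>a\<in>A. P m a \<longrightarrow> a = m"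
  proof (rule predicate_Zorn)
    show "partial_order_on A (relation_of P A)"
      by (rule partial_order_on_relation_ofI) (auto simp: P_def intro: order_trans intro!: ext antisym)
  next
    fix C assume "C \<in> Chains (relation_of P A)"
    then have CA: "C \<subseteq> A" and chain: "\<And>q r. q \<in> C \<Longrightarrow> r \<in> C \<Longrightarrow> P q r \<or> P r q"
      by (auto simp: Chains_def relation_of_def)
    \<comment> \<open>The empty chain is treated apart, because an infimum over it carries no
      information; \<open>p\<close> serves as its bound.\<close>
    show "\<exists>u\<in>A. \<forall>a\<in>C. P a u"
    proof (cases "C = {}")
      case True
      then show ?thesis using p by (auto simp: A_def)
    next
      case False
      have sub: "\<And>q. q \<in> C \<Longrightarrow> sublinear q" and le: "\<And>q x. q \<in> C \<Longrightarrow> q x \<le> p x"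
        using CA by (auto simp: A_def)
      have ch: "\<And>q r. q \<in> C \<Longrightarrow> r \<in> C \<Longrightarrow> (\<forall>x. q x \<le> r x) \<or> (\<forall>x. r x \<le> q x)"
        using chain by (auto simp: P_def)
      have lower: "\<And>q x. q \<in> C \<Longrightarrow> (INF q\<in>C. q x) \<le> q x"
        by (rule sublinear_INF_chain(2)[where p = p]) (use False sub le ch in auto)
      have "sublinear (\<lambda>x. INF q\<in>C. q x)"
        by (rule sublinear_INF_chain(1)[where p = p]) (use False sub le ch in auto)
      moreover have "(INF q\<in>C. q x) \<le> p x" for x
        using False lower le by (meson ex_in_conv order_trans)
      ultimately have "(\<lambda>x. INF q\<in>C. q x) \<in> A" by (simp add: A_def)
      then show ?thesis using lower unfolding P_def by (intro bexI) auto
    qed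
  qed
  then obtain m where m: "sublinear m" "\<And>x. m x \<le> p x"
    and min: "\<And>a. a \<in> A \<Longrightarrow> P m a \<Longrightarrow> a = m"
    by (auto simp: A_def)
  have "linear m"
    using m by (intro minimal_sublinear_linear min) (auto simp: A_def P_def intro: order_trans)
  with m(2) show thesis by (rule that[rotated -1]) 
qed

text \<open>A linear functional below \<open>tilt p a\<close> is below \<open>p\<close> (shift 0)
  and satisfies \<open>f (- a) \<le> - p a\<close> (shift 1), which forces equality at
  \<open>a\<close>.\<close>

lemma Hahn_Banach_sublinear:
  fixes p :: "'v::real_vector \<Rightarrow> real"
  assumes p: "sublinear p"
  obtains f where "linear f" "\<And>x. f x \<le> p x" "f a = p a"
proof -
  obtain f where f: "linear f" "\<And>x. f x \<le> tilt p a x"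
    using linear_below_sublinear[OF sublinear_tilt[OF p]] by blast
  have le: "f x \<le> p x" for x
    using f(2)[of x] tilt_le[OF p, of 0 a x] by simp
  have "f (- a) \<le> - p a"
    using f(2)[of "- a"] tilt_le[OF p, of 1 a "- a"] sublinear_zero[OF p] by simp
  then have "f a = p a" using le[of a] linear_neg[OF f(1), of a] by simp
  with f(1) le show thesis by (rule that)
qed

subsection \<open>Numerical range and the norm\<close>

text \<open>Comparison with the tail of the scalar exponential series. It is applied with
  \<open>k = 2\<close> to the remainder of \<open>exp\<close> and with \<open>k = 5\<close> to the
  combination of four exponentials.\<close>

lemma norm_sums_le_exp_tail:
  fixes f :: "nat \<Rightarrow> 'b::banach"
  assumes f: "f sums s" and zero: "\<And>n. n < k \<Longrightarrow> f n = 0"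
    and le: "\<And>n. n \<ge> k \<Longrightarrow> norm (f n) \<le> c * (r ^ n / fact n)"
  shows "norm s \<le> c * (exp r - (\<Sum>n<k. r ^ n / fact n))"
proof -
  have "(\<lambda>n. r ^ n / fact n) sums exp r"
    using exp_converges[of r] by (simp add: divide_inverse mult.commute)
  then have "(\<lambda>n. r ^ (n + k) / fact (n + k)) sums (exp r - (\<Sum>n<k. r ^ n / fact n))"
    by (rule sums_split_initial_segment)
  then have g: "(\<lambda>n. c * (r ^ (n + k) / fact (n + k))) sums (c * (exp r - (\<Sum>n<k. r ^ n / fact n)))"
    by (rule sums_mult)
  have "(\<lambda>n. f (n + k)) sums (s - (\<Sum>n<k. f n))"
    using f by (rule sums_split_initial_segment)
  then have fk: "(\<lambda>n. f (n + k)) sums s" using zero by simp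
  have "norm (\<Sum>n. f (n + k)) \<le> (\<Sum>n. c * (r ^ (n + k) / fact (n + k)))"
    using g le by (intro norm_suminf_le) (auto simp: sums_iff)
  then show ?thesis using fk g by (simp add: sums_iff)
qed

lemma norm_exp_minus_first_two_terms_le:
  fixes x :: "'b::{real_normed_algebra_1,banach}"
  assumes "norm x \<le> 1"
  shows "norm (exp x - 1 - x) \<le> (norm x)\<^sup>2"
proof -
  define f where "f = (\<lambda>n. if n < 2 then 0 else x ^ n /\<^sub>R fact n)"
  have "(\<lambda>n. x ^ n /\<^sub>R fact n - (if n < 2 then x ^ n /\<^sub>R fact n else 0)) sums
      (exp x - (\<Sum>n | n < 2. x ^ n /\<^sub>R fact n))"
    by (intro sums_diff exp_converges sums_If_finite) simp
  moreover have "(\<Sum>n | n < 2. x ^ n /\<^sub>R fact n) = 1 + x"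
  proof -
    have "{n::nat. n < 2} = {0, 1}" by auto
    then show ?thesis by simp
  qed
  moreover have "f = (\<lambda>n. x ^ n /\<^sub>R fact n - (if n < 2 then x ^ n /\<^sub>R fact n else 0))"
    by (auto simp: f_def)
  ultimately have "f sums (exp x - 1 - x)" by (simp add: diff_diff_eq)
  then have "norm (exp x - 1 - x) \<le> 1 * (exp (norm x) - (\<Sum>n<2. norm x ^ n / fact n))"
    by (rule norm_sums_le_exp_tail)
      (auto simp: f_def divide_inverse mult.commute intro!: mult_right_mono norm_power_ineq)
  also have "\<dots> \<le> (norm x)\<^sup>2"
    using exp_bound[of "norm x"] assms by (simp add: numeral_2_eq_2)
  finally show ?thesis .
qed

lemma exp_of_nat_scaleR:
  fixes x :: "'b::{real_normed_algebra_1,banach}"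
  shows "exp (real m *\<^sub>R x) = exp x ^ m"
proof (induction m)
  case (Suc m)
  have "exp (real (Suc m) *\<^sub>R x) = exp (x + real m *\<^sub>R x)"
    by (simp add: algebra_simps)
  also have "\<dots> = exp x * exp (real m *\<^sub>R x)"
    by (rule exp_add_commuting) simp
  finally show ?case by (simp add: Suc)
qed simp

text \<open>The right derivative at 0 of t \<mapsto> norm (1 + t a).  It dominates the real part of every
functional of norm 1 that takes the value 1 at 1.\<close>

definition norm_slope :: "'b::real_normed_algebra_1 \<Rightarrow> real" where
  "norm_slope a = (INF t\<in>{0<..}. (norm (1 + t *\<^sub>R a) - 1) / t)"

lemma norm_slope_bdd_below:
  fixes a :: "'b::real_normed_algebra_1"
  shows "bdd_below ((\<lambda>t. (norm (1 + t *\<^sub>R a) - 1) / t) ` {0<..})"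
proof (rule bdd_belowI2)
  fix t :: real assume t: "t \<in> {0<..}"
  have "norm (1::'b) - norm (- (t *\<^sub>R a)) \<le> norm (1 - (- (t *\<^sub>R a)))"
    by (rule norm_triangle_ineq2)
  then show "- norm a \<le> (norm (1 + t *\<^sub>R a) - 1) / t"
    using t by (simp add: field_simps)
qed

lemma norm_slope_le:
  "t > 0 \<Longrightarrow> norm_slope a \<le> (norm (1 + t *\<^sub>R a) - 1) / t"
  unfolding norm_slope_def by (rule cINF_lower[OF norm_slope_bdd_below]) simp

lemma norm_slope_le_norm: "norm_slope a \<le> norm a"
  using norm_slope_le[of 1 a] norm_triangle_ineq[of 1 a] by simp

text \<open>Convexity: \<open>1 + s *\<^sub>R a\<close> is a convex combination of \<open>1\<close>
  and \<open>1 + t *\<^sub>R a\<close>. Hence the infimum in \<open>norm_slope\<close> is the limit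
  as \<open>t\<close> decreases to 0.\<close>

lemma norm_slope_mono:
  fixes a :: "'b::real_normed_algebra_1"
  assumes "0 < s" "s \<le> t"
  shows "(norm (1 + s *\<^sub>R a) - 1) / s \<le> (norm (1 + t *\<^sub>R a) - 1) / t"
proof -
  have "1 + s *\<^sub>R a = (1 - s / t) *\<^sub>R 1 + (s / t) *\<^sub>R (1 + t *\<^sub>R a)"
    using assms by (simp add: algebra_simps)
  then have "norm (1 + s *\<^sub>R a) \<le> norm ((1 - s / t) *\<^sub>R (1::'b)) + norm ((s / t) *\<^sub>R (1 + t *\<^sub>R a))"
    using norm_triangle_ineq by metis
  also have "\<dots> = (1 - s / t) + (s / t) * norm (1 + t *\<^sub>R a)"
    using assms by simp
  finally have "norm (1 + s *\<^sub>R a) - 1 \<le> s * ((norm (1 + t *\<^sub>R a) - 1) / t)"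
    using assms by (simp add: algebra_simps diff_divide_distrib)
  then show ?thesis using assms(1) by (simp add: pos_divide_le_eq mult.commute)
qed

text \<open>One good \<open>t0\<close> exists by definition of the infimum, and monotonicity of the
  quotients passes the bound on to every smaller \<open>t\<close>. Two such bounds can therefore be
  used at a common \<open>t\<close>.\<close>

lemma norm_slope_eventually:
  assumes "norm_slope a < c"
  obtains t0 where "t0 > 0" "\<And>t. 0 < t \<Longrightarrow> t \<le> t0 \<Longrightarrow> norm (1 + t *\<^sub>R a) < 1 + t * c"
proof -
  obtain t0 where t0: "t0 > 0" "(norm (1 + t0 *\<^sub>R a) - 1) / t0 < c"
    using assms unfolding norm_slope_def
    by (subst (asm) cINF_less_iff[OF _ norm_slope_bdd_below]) auto
  show thesis
  proof (rule that[OF t0(1)])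
    fix t assume t: "0 < t" "t \<le> t0"
    have "(norm (1 + t *\<^sub>R a) - 1) / t < c"
      using norm_slope_mono[OF t, of a] t0(2) by simp
    then show "norm (1 + t *\<^sub>R a) < 1 + t * c" using t(1) by (simp add: field_simps)
  qed
qed

lemma sublinear_norm_slope: "sublinear (norm_slope :: 'b::real_normed_algebra_1 \<Rightarrow> real)"
  unfolding sublinear_def
proof (intro conjI allI impI)
  fix a b :: 'b
  show "norm_slope (a + b) \<le> norm_slope a + norm_slope b"
  proof (rule field_le_epsilon)
    fix e :: real assume e: "e > 0"
    obtain s where s: "s > 0" "\<And>t. 0 < t \<Longrightarrow> t \<le> s \<Longrightarrow> norm (1 + t *\<^sub>R a) < 1 + t * (norm_slope a + e / 2)"
      using norm_slope_eventually[of a "norm_slope a + e / 2"] e by auto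
    obtain r where r: "r > 0" "\<And>t. 0 < t \<Longrightarrow> t \<le> r \<Longrightarrow> norm (1 + t *\<^sub>R b) < 1 + t * (norm_slope b + e / 2)"
      using norm_slope_eventually[of b "norm_slope b + e / 2"] e by auto
    define t where "t = min s r"
    have t: "t > 0" "t \<le> s" "t \<le> r" using s(1) r(1) by (auto simp: t_def)
    \<comment> \<open>The midpoint of \<open>1 + t *\<^sub>R a\<close> and
      \<open>1 + t *\<^sub>R b\<close> is \<open>1 + (t / 2) *\<^sub>R (a + b)\<close>, so the
      quotient for \<open>a + b\<close> is sampled at \<open>t / 2\<close>.\<close>
    have "2 *\<^sub>R (1 + (t / 2) *\<^sub>R (a + b)) = (1 + t *\<^sub>R a) + (1 + t *\<^sub>R b)"
      by (simp add: algebra_simps scaleR_2)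
    then have "2 * norm (1 + (t / 2) *\<^sub>R (a + b)) \<le> norm (1 + t *\<^sub>R a) + norm (1 + t *\<^sub>R b)"
      using norm_triangle_ineq[of "1 + t *\<^sub>R a" "1 + t *\<^sub>R b"]
      by (metis norm_scaleR abs_numeral)
    also have "\<dots> \<le> 2 + t * (norm_slope a + norm_slope b + e)"
      using s(2)[of t] r(2)[of t] t by (simp add: algebra_simps)
    finally have "(norm (1 + (t / 2) *\<^sub>R (a + b)) - 1) / (t / 2) \<le> norm_slope a + norm_slope b + e"
      using t(1) by (simp add: field_simps)
    then show "norm_slope (a + b) \<le> norm_slope a + norm_slope b + e"
      using norm_slope_le[of "t / 2" "a + b"] t(1) by simp
  qed
next
  fix r :: real and a :: 'b assume "r \<ge> 0"
  show "norm_slope (r *\<^sub>R a) = r * norm_slope a"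
  proof (cases "r = 0")
    case True
    then show ?thesis by (simp add: norm_slope_def)
  next
    case False
    \<comment> \<open>Stated for every positive factor, so that the factor \<open>inverse r\<close>
      yields the reverse inequality.\<close>
    have le: "norm_slope (r *\<^sub>R a) \<le> r * norm_slope a" if "r > 0" for r and a :: 'b
    proof -
      have "norm_slope (r *\<^sub>R a) / r \<le> norm_slope a"
        unfolding norm_slope_def[of a]
      proof (rule cINF_greatest)
        fix t :: real assume t: "t \<in> {0<..}"
        then have "norm_slope (r *\<^sub>R a) \<le> (norm (1 + (t / r) *\<^sub>R (r *\<^sub>R a)) - 1) / (t / r)"
          using that by (intro norm_slope_le) simp
        then show "norm_slope (r *\<^sub>R a) / r \<le> (norm (1 + t *\<^sub>R a) - 1) / t"
          using that t by (simp add: field_simps)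
      qed simp
      then show ?thesis using that by (simp add: field_simps)
    qed
    have "norm_slope a \<le> inverse r * norm_slope (r *\<^sub>R a)"
      using le[of "inverse r" "r *\<^sub>R a"] False \<open>r \<ge> 0\<close> by simp
    then have "r * norm_slope a \<le> norm_slope (r *\<^sub>R a)"
      using False \<open>r \<ge> 0\<close> by (simp add: field_simps)
    then show ?thesis using le[of r a] False \<open>r \<ge> 0\<close> by simp
  qed
qed

text \<open>Write \<open>exp a\<close> as the \<open>m\<close>-th power of
  \<open>exp (t *\<^sub>R a)\<close> with \<open>t = 1 / m\<close>. To first order that factor is
  \<open>1 + t *\<^sub>R a\<close>, whose norm is governed by the slope; the quadratic error is
  absorbed in \<open>e\<close>.\<close>

lemma norm_exp_le_exp_norm_slope:
  fixes a :: "'b::{real_normed_algebra_1,banach}"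
  shows "norm (exp a) \<le> exp (norm_slope a)"
proof -
  have *: "norm (exp a) \<le> exp (norm_slope a + e)" if e: "e > 0" for e
  proof -
    obtain s where s: "s > 0"
      "\<And>t. 0 < t \<Longrightarrow> t \<le> s \<Longrightarrow> norm (1 + t *\<^sub>R a) < 1 + t * (norm_slope a + e / 2)"
      using norm_slope_eventually[of a "norm_slope a + e / 2"] e by auto
    \<comment> \<open>The three summands ensure, in turn, \<open>t \<le> s\<close>,
      \<open>t * norm a \<le> 1\<close> and \<open>t * (norm a)\<^sup>2 \<le> e / 2\<close>.\<close>
    obtain m :: nat where m: "real m > 1 / s + norm a + 2 * (norm a)\<^sup>2 / e"
      using reals_Archimedean2 by blast
    define t where "t = 1 / real m"
    have pos: "1 / s > 0" "norm a \<ge> 0" "2 * (norm a)\<^sup>2 / e \<ge> 0" using s(1) e by auto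
    have m0: "real m > 0" and "1 / s < real m" "norm a < real m" "2 * (norm a)\<^sup>2 / e < real m"
      using m pos by linarith+
    then have t: "t > 0" "t \<le> s" "t * norm a \<le> 1" "t * (norm a)\<^sup>2 \<le> e / 2" "real m * t = 1"
      using s(1) e by (auto simp: t_def field_simps)
    have "exp (t *\<^sub>R a) = (exp (t *\<^sub>R a) - 1 - t *\<^sub>R a) + (1 + t *\<^sub>R a)" by simp
    then have "norm (exp (t *\<^sub>R a)) \<le> norm (exp (t *\<^sub>R a) - 1 - t *\<^sub>R a) + norm (1 + t *\<^sub>R a)"
      using norm_triangle_ineq by metis
    also have "\<dots> \<le> (norm (t *\<^sub>R a))\<^sup>2 + (1 + t * (norm_slope a + e / 2))"
      using t s(2)[of t] norm_exp_minus_first_two_terms_le[of "t *\<^sub>R a"] by simp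
    also have "(norm (t *\<^sub>R a))\<^sup>2 = t * (t * (norm a)\<^sup>2)"
      using t(1) by (simp add: power2_eq_square)
    also have "\<dots> \<le> t * (e / 2)" using t by (intro mult_left_mono) auto
    also have "t * (e / 2) + (1 + t * (norm_slope a + e / 2)) = 1 + t * (norm_slope a + e)"
      by (simp add: algebra_simps)
    also have "\<dots> \<le> exp (t * (norm_slope a + e))" by (rule exp_ge_add_one_self)
    finally have le: "norm (exp (t *\<^sub>R a)) \<le> exp (t * (norm_slope a + e))" by simp
    have "exp a = exp (t *\<^sub>R a) ^ m"
      using t(5) by (simp flip: exp_of_nat_scaleR)
    then have "norm (exp a) \<le> norm (exp (t *\<^sub>R a)) ^ m" by (simp add: norm_power_ineq)
    also have "\<dots> \<le> exp (t * (norm_slope a + e)) ^ m" using le by (intro power_mono) auto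
    also have "\<dots> = exp (norm_slope a + e)"
      using t(5) by (simp flip: exp_of_nat_mult mult.assoc)
    finally show ?thesis .
  qed
  have "((\<lambda>e. exp (norm_slope a + e)) \<longlongrightarrow> exp (norm_slope a + 0)) (at_right 0)"
    by (intro tendsto_intros)
  moreover have "\<forall>\<^sub>F e in at_right 0. norm (exp a) \<le> exp (norm_slope a + e)"
    using eventually_at_right_less by (rule eventually_mono) (rule *)
  ultimately have "norm (exp a) \<le> exp (norm_slope a + 0)"
    by (rule tendsto_lowerbound) simp
  then show ?thesis by simp
qed

section \<open>States of a complex Banach algebra and the norm they control\<close>

locale complex_algebra =
  fixes ii :: "'a::{real_normed_algebra_1,banach}"
  assumes ii_square: "ii * ii = - 1"
    and ii_commute: "ii * x = x * ii"
    and norm_cscale: "norm (cscale ii c x) = cmod c * norm x"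
begin

lemma norm_ii_mult: "norm (ii * x) = norm x"
  using norm_cscale[of \<i> x] by (simp add: cscale_def)

lemma ii_mult_ii_mult: "ii * (ii * x) = - x"
  by (simp add: ii_square flip: mult.assoc)

text \<open>For an imaginary unit \<open>c\<close> the norm of \<open>1 + t c\<close> is
  \<open>sqrt (1 + t\<^sup>2)\<close>, which has derivative 0 at 0. Functionals dominated by the
  slope therefore vanish at \<open>ii\<close>.\<close>

lemma norm_slope_ii: "norm_slope ii \<le> 0" and norm_slope_minus_ii: "norm_slope (- ii) \<le> 0"
proof -
  have *: "norm_slope (cscale ii c 1) \<le> 0" if c: "Re c = 0" "cmod c = 1" for c
  proof (rule field_le_epsilon)
    fix e :: real assume e: "e > 0"
    \<comment> \<open>The quotient is sampled at \<open>t = 2 * e\<close>, where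
      \<open>sqrt (1 + 4 * e\<^sup>2) \<le> 1 + 2 * e\<^sup>2\<close> bounds it by
      \<open>e\<close>.\<close>
    have "norm (1 + (2 * e) *\<^sub>R cscale ii c 1) = norm (cscale ii (1 + of_real (2 * e) * c) 1)"
      by (simp add: cscale_def scaleR_add_right scaleR_add_left add.assoc)
    also have "\<dots> = cmod (1 + of_real (2 * e) * c)" by (simp add: norm_cscale)
    also have "\<dots> = sqrt (1 + (2 * e)\<^sup>2)"
      using c by (simp add: cmod_def power_mult_distrib abs_square_eq_1)
    also have "\<dots> \<le> 1 + 2 * e\<^sup>2"
      by (rule real_le_lsqrt) (use e in \<open>auto simp: power2_eq_square algebra_simps\<close>)
    finally have "(norm (1 + (2 * e) *\<^sub>R cscale ii c 1) - 1) / (2 * e) \<le> 2 * e\<^sup>2 / (2 * e)"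
      using e by (intro divide_right_mono) auto
    also have "2 * e\<^sup>2 / (2 * e) = e" using e by (simp add: power2_eq_square)
    finally show "norm_slope (cscale ii c 1) \<le> 0 + e"
      using norm_slope_le[of "2 * e" "cscale ii c 1"] e by simp
  qed
  show "norm_slope ii \<le> 0" using *[of \<i>] by (simp add: cscale_def)
  show "norm_slope (- ii) \<le> 0" using *[of "- \<i>"] by (simp add: cscale_def)
qed

text \<open>Hahn-Banach on the real space gives a real functional below the slope with the
  prescribed value at \<open>a\<close>; its complexification \<open>g\<close> is the state.\<close>

lemma state_with_real_part_norm_slope:
  assumes E: "1 \<in> E" "a \<in> E" "\<And>x y. x \<in> E \<Longrightarrow> y \<in> E \<Longrightarrow> x + y \<in> E" "\<And>c x. x \<in> E \<Longrightarrow> cscale ii c x \<in> E"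
  obtains \<mu> where "\<mu> \<in> states ii E" "Re (\<mu> a) = norm_slope a"
proof -
  obtain f where lin: "linear f" and le: "\<And>x. f x \<le> norm_slope x" and fa: "f a = norm_slope a"
    using Hahn_Banach_sublinear[OF sublinear_norm_slope] by metis
  interpret linear f by (rule lin)
  define g where "g = (\<lambda>x. Complex (f x) (- f (ii * x)))"
  have g_add: "g (x + y) = g x + g y" for x y
    by (simp add: g_def distrib_left add complex_eq_iff)
  have g_cscale: "g (cscale ii c x) = c * g x" for c x
    by (simp add: g_def cscale_def add diff scale distrib_left ii_mult_ii_mult neg complex_eq_iff algebra_simps)
  have g_le: "cmod (g x) \<le> norm x" for x
  proof (cases "g x = 0")
    case False
    \<comment> \<open>The phase \<open>c\<close> rotates \<open>g x\<close> onto the nonnegative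
      real axis, where \<open>g\<close> agrees with its real part \<open>f\<close>.\<close>
    define c where "c = cnj (g x) / of_real (cmod (g x))"
    have c: "cmod c = 1" using False by (simp add: c_def norm_divide)
    have "g (cscale ii c x) = of_real (cmod (g x))"
      using False complex_norm_square[of "g x"] by (simp add: g_cscale c_def field_simps power2_eq_square)
    then have "cmod (g x) = f (cscale ii c x)"
      by (simp add: g_def complex_eq_iff)
    also have "\<dots> \<le> norm (cscale ii c x)" using le norm_slope_le_norm order_trans by blast
    also have "\<dots> = norm x" by (simp add: norm_cscale c)
    finally show ?thesis .
  qed simp
  \<comment> \<open>At \<open>t = 1\<close> the element \<open>1 - 1\<close> has norm 0. Together
    with the slope of \<open>1\<close> being at most 1, this pins \<open>f 1\<close> to 1.\<close>
  have "norm_slope (- 1 :: 'a) \<le> - 1" using norm_slope_le[of 1 "- 1 :: 'a"] by simp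
  then have "f 1 = 1"
    using le[of 1] le[of "- 1"] norm_slope_le_norm[of "1::'a"] neg[of 1] by simp
  moreover have "f ii = 0"
    using le[of ii] le[of "- ii"] norm_slope_ii norm_slope_minus_ii neg[of ii] by simp
  ultimately have g1: "g 1 = 1" by (simp add: g_def complex_eq_iff)
  show thesis
  proof
    \<comment> \<open>Elements of \<open>states ii E\<close> are extensional on \<open>E\<close>,
      hence the restriction.\<close>
    show "restrict g E \<in> states ii E"
      using E g_add g_cscale g_le g1 by (simp add: states_def)
    show "Re (restrict g E a) = norm_slope a"
      using E(2) by (simp add: g_def fa)
  qed
qed

lemma norm_four_terms:
  fixes a :: "'b::real_normed_vector"
  shows "norm (a - b - c + d) \<le> norm a + norm b + norm c + norm d"
  using norm_triangle_ineq[of "a - b - c" d] norm_triangle_ineq4[of "a - b" c]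
    norm_triangle_ineq4[of a b] by simp

text \<open>The four exponentials filter out the Taylor terms of exp whose degree is 1 modulo 4.\<close>

lemma exp_four_directions:
  assumes "norm x = 3 / 2"
  shows "norm (exp x - exp (- x) - ii * exp (ii * x) + ii * exp (- (ii * x)) - 4 *\<^sub>R x) \<le> 1 / 2"
proof -
  define t where "t = (\<lambda>n. x ^ n /\<^sub>R fact n - (- x) ^ n /\<^sub>R fact n
      - ii * ((ii * x) ^ n /\<^sub>R fact n) + ii * ((- (ii * x)) ^ n /\<^sub>R fact n))"
  define f where "f = (\<lambda>n. t n - (if n = 1 then 4 *\<^sub>R x else 0))"
  have "t sums (exp x - exp (- x) - ii * exp (ii * x) + ii * exp (- (ii * x)))"
    unfolding t_def by (intro sums_add sums_diff sums_mult exp_converges)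
  moreover have "(\<lambda>n. if n = 1 then 4 *\<^sub>R x else 0) sums (4 *\<^sub>R x)"
    using sums_single[of 1 "\<lambda>_. 4 *\<^sub>R x"] by simp
  ultimately have sums: "f sums (exp x - exp (- x) - ii * exp (ii * x) + ii * exp (- (ii * x)) - 4 *\<^sub>R x)"
    unfolding f_def by (rule sums_diff)
  \<comment> \<open>In degrees 0, 2, 3 and 4 the four terms cancel; in degree 1 they add up to
    \<open>4 *\<^sub>R x\<close>, which \<open>f\<close> subtracts.\<close>
  have zero: "f n = 0" if "n < 5" for n
  proof -
    have "ii * x * (ii * x) = ii * (ii * (x * x))" by (metis ii_commute mult.assoc)
    then have pow2: "(ii * x)\<^sup>2 = - x\<^sup>2" by (simp add: power2_eq_square ii_mult_ii_mult)
    have "(ii * x) ^ 3 = ii * x * (ii * x)\<^sup>2"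
      by (simp add: power2_eq_square power3_eq_cube mult.assoc)
    also have "\<dots> = - (ii * x ^ 3)"
      unfolding pow2 by (simp add: power2_eq_square power3_eq_cube mult.assoc)
    finally have pow3: "(ii * x) ^ 3 = - (ii * x ^ 3)" .
    have pow4: "(ii * x) ^ 4 = x ^ 4"
      using power_mult[of "ii * x" 2 2] power_mult[of x 2 2] by (simp add: pow2)
    consider "n = 0" | "n = 1" | "n = 2" | "n = 3" | "n = 4" using \<open>n < 5\<close> by linarith
    then show ?thesis
    proof cases
      case 2
      have "4 *\<^sub>R x = x + x + x + x" by (simp add: scaleR_left_distrib[of 2 2 x, simplified] scaleR_2)
      with 2 show ?thesis by (simp add: f_def t_def ii_mult_ii_mult)
    qed (simp_all add: f_def t_def pow2 pow3 pow4 ii_mult_ii_mult)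
  qed
  have bound: "norm (f n) \<le> 4 * ((3 / 2) ^ n / fact n)" if "n \<ge> 5" for n
  proof -
    have p: "norm (y ^ n /\<^sub>R fact n) \<le> (3 / 2) ^ n / fact n" if "norm y = 3 / 2" for y :: 'a
      using norm_power_ineq[of y n] that by (simp add: divide_simps)
    have "norm (f n) \<le> norm (x ^ n /\<^sub>R fact n) + norm ((- x) ^ n /\<^sub>R fact n)
       + norm (ii * ((ii * x) ^ n /\<^sub>R fact n)) + norm (ii * ((- (ii * x)) ^ n /\<^sub>R fact n))"
      unfolding f_def t_def using that by (simp del: norm_scaleR mult_scaleR_right add: norm_four_terms)
    also have "\<dots> \<le> 4 * ((3 / 2) ^ n / fact n)"
      using p[of x] p[of "- x"] p[of "ii * x"] p[of "- (ii * x)"] assms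
      by (simp only: norm_ii_mult norm_minus_cancel) simp
    finally show ?thesis .
  qed
  \<comment> \<open>The fifth tail of \<open>exp (3 / 2)\<close> is at most
    \<open>9 / 2 - 35 / 8 = 1 / 8\<close>, and four such tails give \<open>1 / 2\<close>. The bound
    on \<open>exp (3 / 2)\<close> comes from cubing \<open>exp 1 < 2.72\<close>.\<close>
  have "exp (3 / 2 :: real) \<le> 9 / 2"
  proof (rule power2_le_imp_le)
    have "(exp (3 / 2 :: real))\<^sup>2 = exp 1 ^ 3"
      by (simp flip: exp_of_nat_mult)
    also have "\<dots> \<le> (272 / 100) ^ 3" using e_less_272 by (intro power_mono) auto
    also have "\<dots> \<le> (9 / 2 :: real)\<^sup>2" by (simp add: eval_nat_numeral)
    finally show "(exp (3 / 2 :: real))\<^sup>2 \<le> (9 / 2)\<^sup>2" .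
  qed simp
  moreover have "(\<Sum>n<5. (3 / 2) ^ n / fact n :: real) \<ge> 35 / 8"
    by (simp add: eval_nat_numeral)
  ultimately show ?thesis
    using norm_sums_le_exp_tail[OF sums, of 5 4 "3 / 2", OF zero bound] by simp
qed

text \<open>If the bound failed, rescaling to \<open>norm x = 3 / 2\<close> would leave all four
  slopes at most \<open>3 / 20\<close>, so that the four exponentials would be too small to produce
  \<open>4 *\<^sub>R x\<close>.\<close>

lemma norm_le_ten_norm_slope:
  assumes slope: "norm_slope a \<le> d" "norm_slope (- a) \<le> d"
    "norm_slope (ii * a) \<le> d" "norm_slope (- (ii * a)) \<le> d"
  shows "norm a \<le> 10 * d"
proof (rule ccontr)
  assume "\<not> norm a \<le> 10 * d"
  then have big: "10 * d < norm a" by simp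
  have "norm_slope (0::'a) \<le> norm_slope a + norm_slope (- a)"
    using sublinear_add[OF sublinear_norm_slope, of a "- a"] by simp
  then have "d \<ge> 0" using slope by (simp add: norm_slope_def)
  then have na: "norm a > 0" using big by linarith
  define r where "r = 3 / (2 * norm a)"
  define x where "x = r *\<^sub>R a"
  have r: "r > 0" using na by (simp add: r_def)
  have "r * d \<le> 3 / 20" using na big by (simp add: r_def field_simps)
  have exp_le: "norm (exp (r *\<^sub>R b)) \<le> 6 / 5" if "norm_slope b \<le> d" for b :: 'a
  proof -
    have "norm (exp (r *\<^sub>R b)) \<le> exp (norm_slope (r *\<^sub>R b))" by (rule norm_exp_le_exp_norm_slope)
    also have "\<dots> \<le> exp (3 / 20)"
      using r order_trans[OF mult_left_mono[OF that, of r] \<open>r * d \<le> 3 / 20\<close>]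
      by (simp add: sublinear_scaleR[OF sublinear_norm_slope])
    also have "\<dots> \<le> 6 / 5" using exp_bound[of "3 / 20"] by (simp add: power2_eq_square)
    finally show ?thesis .
  qed
  have "norm x = 3 / 2" using na by (simp add: x_def r_def)
  define E where "E = exp x - exp (- x) - ii * exp (ii * x) + ii * exp (- (ii * x))"
  have "norm E \<le> norm (exp x) + norm (exp (- x)) + norm (ii * exp (ii * x)) + norm (ii * exp (- (ii * x)))"
    unfolding E_def by (rule norm_four_terms)
  also have "\<dots> \<le> 24 / 5"
    using exp_le[OF slope(1)] exp_le[OF slope(2)] exp_le[OF slope(3)] exp_le[OF slope(4)]
    by (simp add: x_def norm_ii_mult)
  finally have "norm E \<le> 24 / 5" .
  moreover have "norm (E - 4 *\<^sub>R x) \<le> 1 / 2"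
    unfolding E_def by (rule exp_four_directions) fact
  moreover have "norm (4 *\<^sub>R x) \<le> norm E + norm (E - 4 *\<^sub>R x)"
    by (metis norm_triangle_sub norm_minus_commute)
  \<comment> \<open>The left side is 6, while the right side is at most
    \<open>24 / 5 + 1 / 2 = 53 / 10\<close>.\<close>
  ultimately show False using \<open>norm x = 3 / 2\<close> by simp
qed

text \<open>For each of \<open>1\<close>, \<open>- 1\<close>, \<open>\<i>\<close> and
  \<open>- \<i>\<close> as factor \<open>c\<close>, the slope of \<open>c\<close> times
  \<open>a\<close> is the real part of \<open>c * \<mu> a\<close> for some state, hence at most
  \<open>d\<close>.\<close>

lemma norm_le_ten_states:
  assumes E: "1 \<in> E" "\<And>x y. x \<in> E \<Longrightarrow> y \<in> E \<Longrightarrow> x + y \<in> E" "\<And>c x. x \<in> E \<Longrightarrow> cscale ii c x \<in> E"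
    and a: "a \<in> E" and le: "\<And>\<mu>. \<mu> \<in> states ii E \<Longrightarrow> cmod (\<mu> a) \<le> d"
  shows "norm a \<le> 10 * d"
proof -
  have *: "norm_slope (cscale ii c a) \<le> d" if "cmod c = 1" for c
  proof -
    obtain \<mu> where \<mu>: "\<mu> \<in> states ii E" "Re (\<mu> (cscale ii c a)) = norm_slope (cscale ii c a)"
      using state_with_real_part_norm_slope[OF E(1) E(3)[OF a] E(2,3)] by metis
    have "\<mu> (cscale ii c a) = c * \<mu> a" using \<mu>(1) a by (simp add: states_def)
    then have "cmod (\<mu> (cscale ii c a)) \<le> d" using le[OF \<mu>(1)] that by (simp add: norm_mult)
    then show ?thesis using complex_Re_le_cmod[of "\<mu> (cscale ii c a)"] \<mu>(2) by simp
  qed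
  show ?thesis
    using *[of 1] *[of "- 1"] *[of \<i>] *[of "- \<i>"]
    by (intro norm_le_ten_norm_slope) (simp_all add: cscale_def)
qed

end

subsection \<open>Lipschitz balls\<close>

lemma totally_bounded_iff_balls:
  "totally_bounded S \<longleftrightarrow> (\<forall>e>0. \<exists>k. finite k \<and> S \<subseteq> (\<Union>x\<in>k. ball x e))"
  by (simp add: totally_bounded_metric ball_def)

text \<open>Label each \<open>x\<close> by the tuple of net points close to the values
  \<open>f i x\<close>. Only finitely many tuples occur; \<open>F\<close> holds one representative
  for each, and equal labels put all values within \<open>e\<close> of each other. The net lies
  inside \<open>S\<close>, so its elements inherit the properties of \<open>S\<close>.\<close>

lemma totally_bounded_family_finite_net:
  fixes f :: "'i \<Rightarrow> 'b \<Rightarrow> 'c::metric_space"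
  assumes I: "finite I" and tb: "\<forall>i\<in>I. totally_bounded (f i ` S)" and e: "e > 0"
  shows "\<exists>F. finite F \<and> F \<subseteq> S \<and> (\<forall>x\<in>S. \<exists>y\<in>F. \<forall>i\<in>I. dist (f i x) (f i y) < e)"
proof -
  have "\<forall>i\<in>I. \<exists>k. finite k \<and> f i ` S \<subseteq> (\<Union>z\<in>k. ball z (e / 2))"
    using tb half_gt_zero[OF e] unfolding totally_bounded_iff_balls by blast
  then obtain k where k: "\<And>i. i \<in> I \<Longrightarrow> finite (k i)"
    "\<And>i. i \<in> I \<Longrightarrow> f i ` S \<subseteq> (\<Union>z\<in>k i. ball z (e / 2))" by metis
  have "\<exists>z\<in>k i. dist z (f i x) < e / 2" if "i \<in> I" "x \<in> S" for i x
    using k(2)[OF that(1)] that(2) by fastforce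
  then obtain c where c: "\<And>i x. i \<in> I \<Longrightarrow> x \<in> S \<Longrightarrow> c i x \<in> k i \<and> dist (c i x) (f i x) < e / 2"
    by metis
  define g where "g = (\<lambda>x. \<lambda>i\<in>I. c i x)"
  have "g ` S \<subseteq> PiE I k" using c by (auto simp: g_def)
  then have "finite (g ` S)" by (rule finite_subset) (intro finite_PiE I k(1))
  then obtain F where F: "F \<subseteq> S" "finite F" "g ` S = g ` F"
    using finite_subset_image[of "g ` S" g S] by blast
  show ?thesis
  proof (intro exI[of _ F] conjI ballI F)
    fix x assume x: "x \<in> S"
    then obtain y where y: "y \<in> F" "g x = g y" using F(3) by blast
    have "dist (f i x) (f i y) < e" if i: "i \<in> I" for i
    proof -
      have "c i x = c i y" using fun_cong[OF y(2), of i] i by (simp add: g_def)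
      then show ?thesis
        using c[OF i x] c[OF i subsetD[OF F(1) y(1)]] dist_triangle_half_r by metis
    qed
    then show "\<exists>y\<in>F. \<forall>i\<in>I. dist (f i x) (f i y) < e" using y(1) by blast
  qed
qed

lemma totally_bounded_bounded_complex:
  fixes S :: "complex set"
  assumes "\<And>z. z \<in> S \<Longrightarrow> cmod z \<le> R"
  shows "totally_bounded S"
proof (rule totally_bounded_subset)
  have "compact (cball 0 R :: complex set)" by simp
  then show "totally_bounded (cball 0 R :: complex set)"
    unfolding compact_eq_totally_bounded totally_bounded_iff_balls by blast
  show "S \<subseteq> cball 0 R" using assms by auto
qed

text \<open>Banach-Alaoglu: the product of the discs of radius \<open>norm x\<close> is compact by
  Tychonoff, and the states are cut out of it by closed conditions on coordinates.\<close>

lemma compact_space_weak_star_topology: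
  fixes ii :: "'a::real_normed_algebra_1"
  assumes E: "1 \<in> E" "\<And>x y. x \<in> E \<Longrightarrow> y \<in> E \<Longrightarrow> x + y \<in> E" "\<And>c x. x \<in> E \<Longrightarrow> cscale ii c x \<in> E"
  shows "compact_space (weak_star_topology ii E)"
proof -
  let ?P = "product_topology (\<lambda>_::'a. euclidean :: complex topology) E"
  let ?K = "PiE E (\<lambda>x. cball 0 (norm x) :: complex set)"
  have proj: "continuous_map ?P euclidean (\<lambda>\<mu>. \<mu> x)" if "x \<in> E" for x
    using continuous_map_product_projection[OF that, of "\<lambda>_. euclidean"] by simp
  have mulproj: "continuous_map ?P euclidean (\<lambda>\<mu>. c * \<mu> x)" if "x \<in> E" for c x
    using continuous_map_compose[OF proj[OF that], of euclidean "\<lambda>z. c * z"]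
    by (simp add: o_def continuous_on_mult_left)
  have add: "closedin ?P {\<mu> \<in> topspace ?P. \<mu> (x + y) = \<mu> x + \<mu> y}" if "x \<in> E" "y \<in> E" for x y
    using that E(2) by (intro closedin_continuous_maps_eq[where Y = euclidean] continuous_map_add proj) auto
  have scale: "closedin ?P {\<mu> \<in> topspace ?P. \<mu> (cscale ii c x) = c * \<mu> x}" if "x \<in> E" for c x
    using that E(3) by (intro closedin_continuous_maps_eq[where Y = euclidean] mulproj proj) auto
  have one: "closedin ?P {\<mu> \<in> topspace ?P. \<mu> 1 = 1}"
    using E(1) by (intro closedin_continuous_maps_eq[where Y = euclidean] proj) auto
  have "closedin ?P ((\<Inter>x\<in>E. \<Inter>y\<in>E. {\<mu> \<in> topspace ?P. \<mu> (x + y) = \<mu> x + \<mu> y}) \<inter>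
      (\<Inter>c. \<Inter>x\<in>E. {\<mu> \<in> topspace ?P. \<mu> (cscale ii c x) = c * \<mu> x}) \<inter>
      {\<mu> \<in> topspace ?P. \<mu> 1 = 1})" (is "closedin _ ?C")
    using E(1) add scale one by (intro closedin_Int closedin_INT) auto
  moreover have "compactin ?P ?K" by (simp add: compactin_PiE)
  ultimately have "compactin ?P (?C \<inter> ?K)" by (rule closed_Int_compactin)
  moreover have "?C \<inter> ?K = states ii E"
    using E(1) by (auto simp: states_def PiE_def Pi_def)
  ultimately show ?thesis
    by (simp add: weak_star_topology_def compact_space_subtopology)
qed

lemma (in complex_algebra) totally_bounded_Lip_ball:
  assumes E: "1 \<in> E" "\<And>x y. x \<in> E \<Longrightarrow> y \<in> E \<Longrightarrow> x + y \<in> E" "\<And>c x. x \<in> E \<Longrightarrow> cscale ii c x \<in> E"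
    and cqms: "compact_quantum_metric_space star ii E L" and R: "R > 0"
  shows "totally_bounded {a \<in> E. L a \<le> R \<and> norm a \<le> R}" (is "totally_bounded ?B")
  unfolding totally_bounded_iff_balls
proof (intro allI impI)
  fix e :: real assume e: "e > 0"
  define S where "S = states ii E"
  \<comment> \<open>The default value 0 off \<open>S\<close> matches the metric in
    \<open>compact_quantum_metric_space\<close>, so its clauses apply to \<open>d\<close>
    verbatim.\<close>
  define d where "d = (\<lambda>\<mu> \<nu>. if \<mu> \<in> S \<and> \<nu> \<in> S then dL E L \<mu> \<nu> else 0)"
  have bdd: "bdd_above {cmod (\<mu> x - \<nu> x) | x. x \<in> E \<and> L x \<le> 1}" if "\<mu> \<in> S" "\<nu> \<in> S" for \<mu> \<nu>
  proof -
    have "\<forall>\<mu>\<in>S. \<forall>\<nu>\<in>S. bdd_above {cmod (\<mu> x - \<nu> x) | x. x \<in> E \<and> L x \<le> 1}"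
      using cqms unfolding compact_quantum_metric_space_def Let_def S_def by (elim conjE)
    then show ?thesis using that by simp
  qed
  have metric: "Metric_space S d"
    using cqms unfolding compact_quantum_metric_space_def Let_def S_def d_def by (elim conjE)
  have top: "Metric_space.mtopology S d = weak_star_topology ii E"
    using cqms unfolding compact_quantum_metric_space_def Let_def S_def d_def by (elim conjE)
  interpret Metric_space S d by (rule metric)
  have L_scale: "L (cscale ii c x) = cmod c * L x" if "x \<in> E" for c x
    using cqms that by (simp add: compact_quantum_metric_space_def slip_norm_def)
  \<comment> \<open>Dividing \<open>a\<close> by \<open>R\<close> brings it into the set over which
    \<open>dL\<close> takes its supremum.\<close>
  have lip: "cmod (\<mu> a - \<nu> a) \<le> R * d \<mu> \<nu>" if a: "a \<in> ?B" and S: "\<mu> \<in> S" "\<nu> \<in> S" for a \<mu> \<nu>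
  proof -
    let ?b = "cscale ii (of_real (1 / R)) a"
    have b: "?b \<in> E" "L ?b \<le> 1"
      using a R E(3) L_scale by (auto simp: norm_divide field_simps)
    have "\<mu> ?b - \<nu> ?b = of_real (1 / R) * (\<mu> a - \<nu> a)"
      using a S by (simp add: S_def states_def algebra_simps)
    then have "cmod (\<mu> a - \<nu> a) / R = cmod (\<mu> ?b - \<nu> ?b)"
      using R by (simp add: norm_mult norm_divide)
    also have "\<dots> \<le> dL E L \<mu> \<nu>"
      unfolding dL_def by (rule cSup_upper[OF _ bdd[OF S]]) (use b in blast)
    finally show ?thesis using R S by (simp add: d_def field_simps)
  qed
  have "compact_space mtopology"
    unfolding top by (rule compact_space_weak_star_topology) (fact E)+
  then have "compactin mtopology S" by (simp add: compact_space_def)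
  then have "mtotally_bounded S" by (rule compactin_imp_mtotally_bounded)
  \<comment> \<open>Below, states move \<open>a - b\<close> by at most
    \<open>(2 * R + 1) * \<eta>\<close>; the passage from states to the norm costs a factor 10, and
    the total is \<open>e / 2\<close>.\<close>
  define \<eta> where "\<eta> = e / (20 * (2 * R + 1))"
  have "10 * ((2 * R + 1) * \<eta>) = e / 2" using R by (simp add: \<eta>_def divide_eq_eq)
  then have \<eta>: "\<eta> > 0" "10 * ((2 * R + 1) * \<eta>) < e" using e R by (auto simp: \<eta>_def)
  have "\<exists>K. finite K \<and> K \<subseteq> S \<and> S \<subseteq> (\<Union>\<mu>\<in>K. mball \<mu> \<eta>)"
    using \<open>mtotally_bounded S\<close> \<eta>(1) unfolding mtotally_bounded_def by simp
  then obtain K where K: "finite K" "K \<subseteq> S" "S \<subseteq> (\<Union>\<mu>\<in>K. mball \<mu> \<eta>)"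
    by (elim exE conjE)
  have tb: "\<forall>\<mu>\<in>K. totally_bounded (\<mu> ` ?B)"
  proof (intro ballI totally_bounded_bounded_complex)
    fix \<mu> assume "\<mu> \<in> K"
    then have "\<mu> \<in> states ii E" using K(2) by (auto simp: S_def)
    then show "cmod z \<le> R" if "z \<in> \<mu> ` ?B" for z
      using that by (auto simp: states_def intro: order_trans)
  qed
  obtain F where F: "finite F" "F \<subseteq> ?B"
    "\<forall>a\<in>?B. \<exists>b\<in>F. \<forall>\<mu>\<in>K. dist (\<mu> a) (\<mu> b) < \<eta>"
    using totally_bounded_family_finite_net[of K "\<lambda>\<mu>. \<mu>" ?B, OF K(1) tb \<eta>(1)]
    by (elim exE conjE)
  have "a \<in> (\<Union>b\<in>F. ball b e)" if a: "a \<in> ?B" for a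
  proof -
    obtain b where b: "b \<in> F" "\<And>\<mu>. \<mu> \<in> K \<Longrightarrow> dist (\<mu> a) (\<mu> b) < \<eta>" using bspec[OF F(3) a] by blast
    have bB: "b \<in> ?B" using b(1) F(2) by blast
    \<comment> \<open>This is \<open>- b\<close>, written as a complex multiple so that membership
      in \<open>E\<close> and homogeneity of states apply to it.\<close>
    define c where "c = cscale ii (- 1) b"
    have c: "c \<in> E" "c = - b"
      using bB E(3)[of b "- 1"] by (simp add: c_def) (simp add: c_def cscale_def)
    have aE: "a \<in> E" using a by blast
    have small: "cmod (\<nu> (a + c)) \<le> (2 * R + 1) * \<eta>" if \<nu>: "\<nu> \<in> states ii E" for \<nu>
    proof -
      have \<nu>S: "\<nu> \<in> S" using \<nu> by (simp add: S_def)
      then have "\<nu> \<in> (\<Union>\<mu>\<in>K. mball \<mu> \<eta>)" using K(3) by (rule subsetD[rotated])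
      then obtain \<mu> where \<mu>: "\<mu> \<in> K" "\<nu> \<in> mball \<mu> \<eta>" by (rule UN_E)
      then have \<mu>S: "\<mu> \<in> S" and near_d: "d \<mu> \<nu> < \<eta>" by (simp_all add: in_mball)
      have near: "cmod (\<mu> z - \<nu> z) \<le> R * \<eta>" if "z \<in> ?B" for z
        using lip[OF that \<mu>S \<nu>S] mult_left_mono[of "d \<mu> \<nu>" \<eta> R] near_d R by linarith
      have "\<nu> (a + c) = \<nu> a + \<nu> c" using \<nu> aE c(1) by (simp add: states_def)
      also have "\<nu> c = - \<nu> b" using \<nu> bB by (simp add: states_def c_def)
      \<comment> \<open>The state \<open>\<nu>\<close> is exchanged for a net point
        \<open>\<mu>\<close> at both \<open>a\<close> and \<open>b\<close>, at cost
        \<open>R * \<eta>\<close> each; at \<open>\<mu>\<close> the two values differ by less than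
        \<open>\<eta>\<close>.\<close>
      also have "\<nu> a + - \<nu> b = (\<mu> b - \<nu> b) - (\<mu> a - \<nu> a) + (\<mu> a - \<mu> b)" by simp
      finally have "cmod (\<nu> (a + c)) \<le> cmod (\<mu> b - \<nu> b) + cmod (\<mu> a - \<nu> a) + cmod (\<mu> a - \<mu> b)"
        using norm_triangle_ineq[of "(\<mu> b - \<nu> b) - (\<mu> a - \<nu> a)" "\<mu> a - \<mu> b"]
          norm_triangle_ineq4[of "\<mu> b - \<nu> b" "\<mu> a - \<nu> a"] by simp
      also have "\<dots> \<le> R * \<eta> + R * \<eta> + \<eta>"
        using near[OF a] near[OF bB] b(2)[OF \<mu>(1)] by (intro add_mono) (simp_all add: dist_norm)
      finally show ?thesis by (simp add: algebra_simps)
    qed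
    have "norm (a + c) \<le> 10 * ((2 * R + 1) * \<eta>)"
    proof (rule norm_le_ten_states)
      show "a + c \<in> E" using aE c(1) by (rule E(2))
    qed (fact E small)+
    then have "dist b a < e" using \<eta>(2) c(2) by (simp add: dist_norm norm_minus_commute)
    then show ?thesis using b(1) by auto
  qed
  then have "?B \<subseteq> (\<Union>b\<in>F. ball b e)" by (rule subsetI)
  with F(1) show "\<exists>k. finite k \<and> ?B \<subseteq> (\<Union>x\<in>k. ball x e)"
    by (intro exI[of _ F] conjI)
qed

subsection \<open>Hilbert modules\<close>

lemma unital_cstar_algebraD:
  assumes "unital_cstar_algebra star ii"
  shows "complex_algebra ii"
    and "star (x + y) = star x + star y"
    and "star (x * y) = star y * star x"
    and "star (star x) = x"
    and "star (cscale ii c x) = cscale ii (cnj c) (star x)"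
    and "norm (star x * x) = (norm x)\<^sup>2"
proof -
  have ii: "ii * ii = - 1" "\<forall>x. ii * x = x * ii" "\<forall>c x. norm (cscale ii c x) = cmod c * norm x"
    and star: "\<forall>x y. star (x + y) = star x + star y" "\<forall>x y. star (x * y) = star y * star x"
      "\<forall>x. star (star x) = x" "\<forall>c x. star (cscale ii c x) = cscale ii (cnj c) (star x)"
      "\<forall>x. norm (star x * x) = (norm x)\<^sup>2"
    using assms unfolding unital_cstar_algebra_def by - (elim conjE, assumption)+
  show "complex_algebra ii"
    using ii by unfold_locales (blast | simp)+
  show "star (x + y) = star x + star y" "star (x * y) = star y * star x" "star (star x) = x"
      "star (cscale ii c x) = cscale ii (cnj c) (star x)" "norm (star x * x) = (norm x)\<^sup>2"
    using star by blast+
qed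

lemma right_hilbert_moduleD:
  assumes "right_hilbert_module star ii act ip"
  shows "act x (a + b) = act x a + act x b"
    and "ip x (y + z) = ip x y + ip x z"
    and "ip x (act y a) = ip x y * a"
    and "ip y x = star (ip x y)"
    and "norm (ip x x) = (norm x)\<^sup>2"
proof -
  have *: "\<forall>x a b. act x (a + b) = act x a + act x b" "\<forall>x y z. ip x (y + z) = ip x y + ip x z"
    "\<forall>x y a. ip x (act y a) = ip x y * a" "\<forall>x y. ip y x = star (ip x y)"
    and norm: "\<forall>x. norm x = sqrt (norm (ip x x))"
    using assms unfolding right_hilbert_module_def by - (elim conjE, assumption)+
  show "act x (a + b) = act x a + act x b" "ip x (y + z) = ip x y + ip x z"
    "ip x (act y a) = ip x y * a" "ip y x = star (ip x y)"
    using * by blast+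
  show "norm (ip x x) = (norm x)\<^sup>2" using norm by simp
qed

text \<open>The C*-identity and submultiplicativity give one inequality; applying it to
  \<open>star x\<close> gives the other.\<close>

lemma unital_cstar_algebra_norm_star:
  assumes A: "unital_cstar_algebra star ii"
  shows "norm (star x) = norm x"
proof -
  have le: "norm y \<le> norm (star y)" for y
  proof (cases "y = 0")
    case False
    have "(norm y)\<^sup>2 = norm (star y * y)" by (simp add: unital_cstar_algebraD[OF A])
    also have "\<dots> \<le> norm (star y) * norm y" by (rule norm_mult_ineq)
    finally show ?thesis using False by (simp add: power2_eq_square)
  qed simp
  show ?thesis using le[of x] le[of "star x"] by (simp add: unital_cstar_algebraD[OF A])
qed

lemma unital_cstar_algebra_star_ii:
  assumes A: "unital_cstar_algebra star ii"
  shows "star ii = - ii"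
proof -
  have "star (star 1 * 1) = star 1 * star (star 1)" by (rule unital_cstar_algebraD[OF A])
  then have "star 1 = 1" by (simp add: unital_cstar_algebraD(4)[OF A])
  then show ?thesis using unital_cstar_algebraD(5)[OF A, of \<i> 1] by (simp add: cscale_def)
qed

text \<open>The inner square of \<open>act x a\<close> is \<open>star a * star (ip x x) * a\<close>,
  whose norm is bounded by submultiplicativity and the isometry of \<open>star\<close>.\<close>

lemma hilbert_module_norm_act_le:
  assumes A: "unital_cstar_algebra star ii" and X: "right_hilbert_module star ii act ip"
  shows "norm (act x a) \<le> norm x * norm a"
proof -
  note norm_sq = right_hilbert_moduleD(5)[OF X]
  have "ip (act x a) (act x a) = star (ip x (act x a)) * a"
    by (subst right_hilbert_moduleD(3)[OF X], subst right_hilbert_moduleD(4)[OF X]) (rule refl)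
  also have "\<dots> = star a * star (ip x x) * a"
    by (simp add: right_hilbert_moduleD(3)[OF X] unital_cstar_algebraD(3)[OF A])
  finally have "(norm (act x a))\<^sup>2 = norm (star a * star (ip x x) * a)" by (simp flip: norm_sq)
  also have "\<dots> \<le> norm (star a * star (ip x x)) * norm a" by (rule norm_mult_ineq)
  also have "\<dots> \<le> norm (star a) * norm (star (ip x x)) * norm a"
    by (intro mult_right_mono norm_mult_ineq) simp
  also have "\<dots> = (norm x * norm a)\<^sup>2"
    by (simp add: unital_cstar_algebra_norm_star[OF A] norm_sq power2_eq_square)
  finally show ?thesis by (rule power2_le_imp_le) simp
qed

text \<open>A weak Cauchy-Schwarz inequality, obtained by polarization alone.\<close>

lemma hilbert_module_norm_ip_le:
  assumes A: "unital_cstar_algebra star ii" and X: "right_hilbert_module star ii act ip"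
  shows "norm (ip x y) \<le> 2 * (norm x + norm y)\<^sup>2"
proof -
  interpret complex_algebra ii by (rule unital_cstar_algebraD(1)[OF A])
  note norm_sq = right_hilbert_moduleD(5)[OF X]
  \<comment> \<open>Polarization bounds twice the real part of \<open>ip x z\<close>. The vector
    \<open>z\<close> stays free because it is taken to be \<open>y\<close> and then
    \<open>act y ii\<close>.\<close>
  have re: "norm (ip x z + star (ip x z)) \<le> 2 * (norm x + norm y)\<^sup>2" if z: "norm z \<le> norm y" for z
  proof -
    have add_left: "ip (x + z) w = ip x w + ip z w" for w
      using right_hilbert_moduleD(4)[OF X, of "x + z" w] right_hilbert_moduleD(4)[OF X, of x w]
        right_hilbert_moduleD(4)[OF X, of z w]
      by (simp add: right_hilbert_moduleD(2)[OF X] unital_cstar_algebraD(2)[OF A])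
    have "ip x z + star (ip x z) = ip (x + z) (x + z) - ip x x - ip z z"
      using right_hilbert_moduleD(4)[OF X, of z x]
      by (simp add: add_left right_hilbert_moduleD(2)[OF X])
    then have "norm (ip x z + star (ip x z)) \<le> (norm (x + z))\<^sup>2 + (norm x)\<^sup>2 + (norm z)\<^sup>2"
      using norm_triangle_ineq4[of "ip (x + z) (x + z) - ip x x" "ip z z"]
        norm_triangle_ineq4[of "ip (x + z) (x + z)" "ip x x"] by (simp add: norm_sq)
    also have "\<dots> \<le> (norm x + norm y)\<^sup>2 + (norm x)\<^sup>2 + (norm y)\<^sup>2"
      using z norm_triangle_ineq[of x z] by (intro add_mono power_mono) auto
    also have "\<dots> \<le> 2 * (norm x + norm y)\<^sup>2"
      by (simp add: power2_eq_square algebra_simps)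
    finally show ?thesis .
  qed
  let ?h = "ip x y"
  have "norm ii = 1" using norm_ii_mult[of 1] by simp
  then have "norm (act y ii) \<le> norm y"
    using hilbert_module_norm_act_le[OF A X, of y ii] by simp
  moreover have "ip x (act y ii) = ?h * ii"
    by (rule right_hilbert_moduleD(3)[OF X])
  moreover have "star (?h * ii) = - (ii * star ?h)"
  proof -
    have "star (?h * ii) = star ii * star ?h"
      by (rule unital_cstar_algebraD(3)[OF A])
    then show ?thesis by (simp add: unital_cstar_algebra_star_ii[OF A])
  qed
  ultimately have "norm (?h * ii + - (ii * star ?h)) \<le> 2 * (norm x + norm y)\<^sup>2"
    using re[of "act y ii"] by simp
  \<comment> \<open>The choice \<open>act y ii\<close> turns the real part into the imaginary part,
    since \<open>ii\<close> is central and \<open>star ii = - ii\<close>.\<close>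
  also have "?h * ii + - (ii * star ?h) = ii * (?h - star ?h)"
    using ii_commute[of ?h] by (simp add: right_diff_distrib)
  finally have im: "norm (?h - star ?h) \<le> 2 * (norm x + norm y)\<^sup>2"
    by (simp add: norm_ii_mult)
  have "2 *\<^sub>R ?h = (?h + star ?h) + (?h - star ?h)" by (simp add: scaleR_2)
  then have "2 * norm ?h \<le> norm (?h + star ?h) + norm (?h - star ?h)"
    by (metis norm_triangle_ineq norm_scaleR abs_numeral)
  then show ?thesis using re[of y] im by simp
qed

section \<open>Transport of total boundedness to the module by the frame\<close>

theorem theorem3p8:
  fixes star :: "'a::{real_normed_algebra_1,banach} \<Rightarrow> 'a" and ii :: 'a
    and A0 :: "'a set"
    and act :: "'x::{real_normed_vector,banach} \<Rightarrow> 'a \<Rightarrow> 'x" and ip :: "'x \<Rightarrow> 'x \<Rightarrow> 'a"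
    and X0 :: "'x set"
    and L :: "'x \<Rightarrow> real" and L0 :: "'a \<Rightarrow> real"
    and n :: nat and \<zeta> :: "nat \<Rightarrow> 'x" and C C0 :: real
  assumes "unital_cstar_algebra star ii"
    and "unital_star_subalgebra star ii A0" and "closure A0 = UNIV"
    and "right_hilbert_module star ii act ip"
    and "0 \<in> X0" and "\<forall>x\<in>X0. \<forall>y\<in>X0. x + y \<in> X0"
    and "\<forall>c. \<forall>x\<in>X0. mscale act ii c x \<in> X0"
    and "closure X0 = UNIV"
    and "\<forall>x\<in>X0. \<forall>a\<in>A0. act x a \<in> X0"
    and "\<forall>x\<in>X0. \<forall>y\<in>X0. ip x y \<in> A0"
    and "module_seminorm_on act ii X0 L"
    and "compact_quantum_metric_space star ii A0 L0"
    and "finite_frame act ip X0 n \<zeta>"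
    and "C \<ge> 0" and "\<forall>x\<in>X0. norm x \<le> C * L x"
    and "C0 \<ge> 0" and "\<forall>x\<in>X0. \<forall>j<n. L0 (ip (\<zeta> j) x) \<le> C0 * (L x + norm x)"
  shows "totally_bounded {x \<in> X0. L x \<le> 1}"
proof -
  note A = assms(1) and X = assms(4)
  interpret complex_algebra ii by (rule unital_cstar_algebraD(1)[OF A])
  have A0: "1 \<in> A0" "\<And>x y. x \<in> A0 \<Longrightarrow> y \<in> A0 \<Longrightarrow> x + y \<in> A0" "\<And>c x. x \<in> A0 \<Longrightarrow> cscale ii c x \<in> A0"
    using assms(2) by (auto simp: unital_star_subalgebra_def)
  have \<zeta>: "\<zeta> j \<in> X0" if "j < n" for j
    using assms(13) that by (simp add: finite_frame_def)
  let ?S = "{x \<in> X0. L x \<le> 1}"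
  have norm_le: "norm x \<le> C" if "x \<in> ?S" for x
    using assms(14,15) that mult_left_mono[of "L x" 1 C] by fastforce
  \<comment> \<open>One radius for every frame coefficient: the first summand bounds
    \<open>L0\<close>, the second bounds the norm, and the final 1 makes \<open>R\<close>
    positive.\<close>
  define R where "R = C0 * (1 + C) + (\<Sum>j<n. 2 * (norm (\<zeta> j) + C)\<^sup>2) + 1"
  have R0: "C0 * (1 + C) \<ge> 0" "(\<Sum>j<n. 2 * (norm (\<zeta> j) + C)\<^sup>2) \<ge> 0"
    using assms(14,16) by (auto intro: sum_nonneg)
  then have "R > 0" by (simp add: R_def)
  have coeff: "ip (\<zeta> j) x \<in> {a \<in> A0. L0 a \<le> R \<and> norm a \<le> R}" if j: "j < n" and x: "x \<in> ?S" for j x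
  proof -
    have "L0 (ip (\<zeta> j) x) \<le> C0 * (L x + norm x)" using assms(17) j x by blast
    also have "\<dots> \<le> C0 * (1 + C)"
      using x norm_le[OF x] assms(16) by (intro mult_left_mono add_mono) auto
    finally have "L0 (ip (\<zeta> j) x) \<le> R" using R0 by (simp add: R_def)
    have "norm (ip (\<zeta> j) x) \<le> 2 * (norm (\<zeta> j) + norm x)\<^sup>2"
      by (rule hilbert_module_norm_ip_le[OF A X])
    also have "\<dots> \<le> 2 * (norm (\<zeta> j) + C)\<^sup>2"
      using norm_le[OF x] by (intro mult_left_mono power_mono add_left_mono) auto
    also have "\<dots> \<le> (\<Sum>j<n. 2 * (norm (\<zeta> j) + C)\<^sup>2)"
      using j by (intro member_le_sum) auto
    finally have "norm (ip (\<zeta> j) x) \<le> R" using R0 by (simp add: R_def)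
    moreover have "ip (\<zeta> j) x \<in> A0" using assms(10) \<zeta>[OF j] x by blast
    ultimately show ?thesis using \<open>L0 (ip (\<zeta> j) x) \<le> R\<close> by simp
  qed
  have lip: "totally_bounded {a \<in> A0. L0 a \<le> R \<and> norm a \<le> R}"
    using A0 by (rule totally_bounded_Lip_ball[OF _ _ _ assms(12) \<open>R > 0\<close>])
  have tb: "\<forall>j\<in>{..<n}. totally_bounded (ip (\<zeta> j) ` ?S)"
  proof
    fix j assume "j \<in> {..<n}"
    then have "ip (\<zeta> j) ` ?S \<subseteq> {a \<in> A0. L0 a \<le> R \<and> norm a \<le> R}"
      using coeff by (intro image_subsetI) simp
    then show "totally_bounded (ip (\<zeta> j) ` ?S)"
      by (rule totally_bounded_subset[OF lip])
  qed
  have act_diff: "act z (a - b) = act z a - act z b" for z a b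
  proof -
    have "act z ((a - b) + b) = act z (a - b) + act z b"
      by (rule right_hilbert_moduleD(1)[OF X])
    then show ?thesis by simp
  qed
  show ?thesis
    unfolding totally_bounded_iff_balls
  proof (intro allI impI)
    fix e :: real assume e: "e > 0"
    \<comment> \<open>Coefficient errors below \<open>e / (1 + s)\<close> add up to at most
      \<open>s * (e / (1 + s)) < e\<close>; the summand 1 also covers the case
      \<open>s = 0\<close>.\<close>
    define s where "s = (\<Sum>j<n. norm (\<zeta> j))"
    have s: "s \<ge> 0" by (auto simp: s_def intro: sum_nonneg)
    then have e': "e / (1 + s) > 0" using e by simp
    obtain F where F: "finite F" "F \<subseteq> ?S"
      "\<forall>x\<in>?S. \<exists>y\<in>F. \<forall>j\<in>{..<n}. dist (ip (\<zeta> j) x) (ip (\<zeta> j) y) < e / (1 + s)"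
      using totally_bounded_family_finite_net[of "{..<n}" "\<lambda>j. ip (\<zeta> j)" ?S, OF finite_lessThan tb e']
      by (elim exE conjE)
    have "x \<in> (\<Union>y\<in>F. ball y e)" if x: "x \<in> ?S" for x
    proof -
      obtain y where y: "y \<in> F" "\<And>j. j < n \<Longrightarrow> dist (ip (\<zeta> j) x) (ip (\<zeta> j) y) < e / (1 + s)"
        using bspec[OF F(3) x] by auto
      have "(\<Sum>j<n. act (\<zeta> j) (ip (\<zeta> j) z)) = z" if "z \<in> X0" for z
        using assms(13) that by (simp add: finite_frame_def)
      from this[of x] this[of y]
      \<comment> \<open>Both \<open>x\<close> and \<open>y\<close> lie in \<open>X0\<close>, so both
        are reconstructed from their coefficients and the difference involves coefficient
        differences only.\<close>
      have "x - y = (\<Sum>j<n. act (\<zeta> j) (ip (\<zeta> j) x - ip (\<zeta> j) y))"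
        using x y(1) F(2) by (auto simp: act_diff sum_subtractf)
      also have "norm \<dots> \<le> (\<Sum>j<n. norm (\<zeta> j) * (e / (1 + s)))"
      proof (rule sum_norm_le)
        fix j assume "j \<in> {..<n}"
        then have "norm (ip (\<zeta> j) x - ip (\<zeta> j) y) \<le> e / (1 + s)"
          using y(2)[of j] by (simp add: dist_norm)
        then show "norm (act (\<zeta> j) (ip (\<zeta> j) x - ip (\<zeta> j) y)) \<le> norm (\<zeta> j) * (e / (1 + s))"
          by (intro order_trans[OF hilbert_module_norm_act_le[OF A X]] mult_left_mono) auto
      qed
      also have "\<dots> = s * (e / (1 + s))" unfolding s_def by (rule sum_distrib_right[symmetric])
      also have "\<dots> < e" using e s by (simp add: field_simps)
      finally show ?thesis using y(1) by (auto simp: dist_norm norm_minus_commute)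
    qed
    then show "\<exists>k. finite k \<and> ?S \<subseteq> (\<Union>x\<in>k. ball x e)" using F(1) by blast
  qed
qed

end
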